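(* Let $\{A_t\}_{t>0}$ be a continuous group of linear operators on $\mathbb{R}^n$ with generator $P$ (so $A_t=\exp(P\ln t)$ for all $t>0$). Then the following are equivalent. (a) For all $x\in\mathbb{R}^n$, $\lim_{t\to 0}|A_t x|=0$. (b) All (complex) eigenvalues $\lambda$ of $P$ satisfy $\operatorname{Re}(\lambda)>0$. (c) There exists $t_0>1$ such that $|A_{t_0}x|>|x|$ for all $x\in\mathbb{R}^n\setminus\{0\}$.
   Context: A continuous group $\{A_t\}_{t>0}$ is a (multiplicative one-parameter) group of linear operators $A_t:\mathbb{R}^n\to\mathbb{R}^n$ with $A_tA_s=A_{st}$ for all $s,t>0$ and such that $t\mapsto A_tx$ is continuous for every $x\in\mathbb{R}^n$. Such a group has the form $A_t=\exp(P\ln t)$, $t>0$, for a unique real $n\times n$ matrix $P$, called its generator. $|\cdot|$ is the Euclidean norm. *)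

theory Defs
  imports "HOL-Analysis.Analysis"
begin

(* The ring multiplication and power of type real^'n^'n are componentwise, so the library
   functions (^) and exp do not give the matrix power and the matrix exponential. *)

primrec matrix_power :: "real^'n^'n \<Rightarrow> nat \<Rightarrow> real^'n^'n" where
  "matrix_power M 0 = mat 1"
| "matrix_power M (Suc k) = M ** matrix_power M k"

definition matrix_exp :: "real^'n^'n \<Rightarrow> real^'n^'n" where
  "matrix_exp M = (\<Sum>k. (1 / fact k) *\<^sub>R matrix_power M k)"

(* Only the values A t with t > 0 matter. The condition A 1 = id says that the operators form
   a group of invertible maps and excludes degenerate semigroups such as A t = 0. *)

definition continuous_group :: "(real \<Rightarrow> real^'n \<Rightarrow> real^'n) \<Rightarrow> bool" where
  "continuous_group A \<longleftrightarrow>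
     (\<forall>t>0. linear (A t)) \<and>
     A 1 = id \<and>
     (\<forall>t>0. \<forall>s>0. A t \<circ> A s = A (s * t)) \<and>
     (\<forall>x. continuous_on {0<..} (\<lambda>t. A t x))"

definition generator :: "(real \<Rightarrow> real^'n \<Rightarrow> real^'n) \<Rightarrow> real^'n^'n \<Rightarrow> bool" where
  "generator A P \<longleftrightarrow> (\<forall>t>0. \<forall>x. A t x = matrix_exp (ln t *\<^sub>R P) *v x)"

definition complex_eigenvalue :: "real^'n^'n \<Rightarrow> complex \<Rightarrow> bool" where
  "complex_eigenvalue P \<mu> \<longleftrightarrow>
     (\<exists>v::complex^'n. v \<noteq> 0 \<and> map_matrix complex_of_real P *v v = \<mu> *s v)"

end

theory Submission
  imports Defs "HOL-Computational_Algebra.Fundamental_Theorem_Algebra"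
begin

text \<open>
  If \<open>A\<^sub>t x \<rightarrow> 0\<close> for every \<open>x\<close>, then some \<open>A\<^sub>t\<close> with \<open>t < 1\<close> has operator norm below \<open>1\<close>, so its
  inverse \<open>A\<^bsub>1/t\<^esub>\<close> is strictly expanding. If \<open>A\<^sub>t\<close> with \<open>t > 1\<close> is strictly expanding, so is its
  complexification, which maps an eigenvector \<open>v\<close> of \<open>P\<close> to \<open>t\<^sup>\<mu> v\<close>; hence \<open>\<bar>t\<^sup>\<mu>\<bar> > 1\<close>. If all
  eigenvalues have positive real part, every complex vector is annihilated by a nonzero polynomial in
  \<open>P\<close>, and its orbit tends to \<open>0\<close> by induction on the degree, without any normal form.
\<close>

section \<open>Convergence of the exponential series\<close>

lemma norm_matrix_iterate_le:
  fixes M :: "'a::{euclidean_space,real_normed_field}^'n^'n"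
  obtains K where "\<And>k v. norm (((*v) M ^^ k) v) \<le> K ^ k * norm v"
proof -
  obtain K where K: "K > 0" "\<And>v. norm (M *v v) \<le> norm v * K"
    using bounded_linear.pos_bounded[OF matrix_vector_mul_bounded_linear[of M]] by blast
  have "norm (((*v) M ^^ k) v) \<le> K ^ k * norm v" for k v
  proof (induction k)
    case (Suc k)
    have "norm (((*v) M ^^ Suc k) v) \<le> norm (((*v) M ^^ k) v) * K"
      using K(2) by simp
    also have "\<dots> \<le> (K ^ k * norm v) * K"
      using Suc K(1) by (intro mult_right_mono) auto
    finally show ?case by (simp add: mult_ac)
  qed simp
  then show ?thesis by (rule that)
qed

text \<open>Comparison with the scalar exponential series at \<open>K * norm z\<close>. The general
  field serves both the real matrix exponential and complex orbits, and the power series form in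
  \<open>z\<close> allows termwise differentiation.\<close>

lemma summable_matrix_exp_component:
  fixes M :: "'a::{euclidean_space,real_normed_field}^'n^'n"
  shows "summable (\<lambda>k. ((((*v) M ^^ k) v) $ i / fact k) * z ^ k)"
proof -
  obtain K where K: "\<And>k v. norm (((*v) M ^^ k) v) \<le> K ^ k * norm v"
    by (rule norm_matrix_iterate_le[of M]) blast
  have "summable (\<lambda>k. norm v * (inverse (fact k) * (K * norm z) ^ k))"
    by (intro summable_mult summable_exp)
  moreover have "norm (((((*v) M ^^ k) v) $ i / fact k) * z ^ k)
      \<le> norm v * (inverse (fact k) * (K * norm z) ^ k)" for k
  proof -
    have "norm ((((*v) M ^^ k) v) $ i) \<le> K ^ k * norm v"
      using K[of k v] Finite_Cartesian_Product.norm_nth_le[of "((*v) M ^^ k) v" i] by linarith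
    then have "norm ((((*v) M ^^ k) v) $ i) * (norm z ^ k / fact k)
        \<le> (K ^ k * norm v) * (norm z ^ k / fact k)"
      by (intro mult_right_mono) auto
    then show ?thesis
      by (simp add: norm_mult norm_divide norm_power power_mult_distrib field_simps)
  qed
  ultimately show ?thesis
    by (rule summable_comparison_test'[where N = 0])
qed

lemma matrix_power_vector_mult: "matrix_power M k *v v = ((*v) M ^^ k) v"
  by (induction k) (simp_all flip: matrix_vector_mul_assoc)

lemma matrix_power_scaleR: "matrix_power (r *\<^sub>R M) k = r ^ k *\<^sub>R matrix_power M k"
  by (induction k)
    (simp_all add: matrix_matrix_mult_def vec_eq_iff sum_distrib_left mult_ac)

lemma summable_matrix_exp:
  fixes M :: "real^'n^'n"
  shows "summable (\<lambda>k. (1 / fact k) *\<^sub>R matrix_power M k)"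
proof -
  have "summable (\<lambda>k. ((1 / fact k) *\<^sub>R matrix_power M k) $ i $ j)" for i j
  proof -
    \<comment> \<open>Column j of a matrix is its value on the j-th basis vector, so the entries of
      the series are the component series at \<open>z = 1\<close>.\<close>
    have "matrix_power M k $ i $ j = (((*v) M ^^ k) (axis j 1)) $ i" for k
      by (simp add: matrix_vector_mult_basis column_def flip: matrix_power_vector_mult)
    then show ?thesis
      using summable_matrix_exp_component[of M "axis j 1" i 1] by simp
  qed
  then have "(\<lambda>k. ((1 / fact k) *\<^sub>R matrix_power M k) $ i $ j) sums
      (\<chi> i j. \<Sum>k. ((1 / fact k) *\<^sub>R matrix_power M k) $ i $ j) $ i $ j" for i j
    by (simp add: summable_sums)
  then have "(\<lambda>k. (1 / fact k) *\<^sub>R matrix_power M k) sums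
      (\<chi> i j. \<Sum>k. ((1 / fact k) *\<^sub>R matrix_power M k) $ i $ j)"
    unfolding sums_def by (intro vec_tendstoI) (simp only: sum_component)
  then show ?thesis by (rule sums_summable)
qed

text \<open>Evaluating at \<open>x\<close> and taking a coordinate is a bounded linear functional of
  the matrix, so it passes through the infinite sum.\<close>

lemma matrix_exp_vector_component:
  fixes M :: "real^'n^'n"
  shows "(matrix_exp (r *\<^sub>R M) *v x) $ i = (\<Sum>k. ((((*v) M ^^ k) x) $ i / fact k) * r ^ k)"
proof -
  have bl: "bounded_linear (\<lambda>N::real^'n^'n. (N *v x) $ i)"
    by (rule linear_conv_bounded_linear[THEN iffD1], rule linearI)
      (simp_all add: matrix_vector_mult_add_rdistrib scaleR_matrix_vector_assoc[symmetric])
  have "(matrix_exp (r *\<^sub>R M) *v x) $ i =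
      (\<Sum>k. (((1 / fact k) *\<^sub>R matrix_power (r *\<^sub>R M) k) *v x) $ i)"
    unfolding matrix_exp_def
    by (rule bounded_linear.suminf[OF bl summable_matrix_exp])
  also have "\<dots> = (\<Sum>k. ((((*v) M ^^ k) x) $ i / fact k) * r ^ k)"
    by (simp add: matrix_power_scaleR matrix_power_vector_mult mult_ac
        flip: scaleR_matrix_vector_assoc)
  finally show ?thesis .
qed

section \<open>Orbits of a complex matrix exponential\<close>

text \<open>This is exp(zM) v. Each coordinate is a scalar power series in \<open>z\<close>, which
  avoids a separate exponential of complex matrices.\<close>

definition exp_orbit :: "complex^'n^'n \<Rightarrow> complex^'n \<Rightarrow> complex \<Rightarrow> complex^'n" where
  "exp_orbit M v z = (\<chi> i. \<Sum>k. ((((*v) M ^^ k) v) $ i / fact k) * z ^ k)"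

lemma matrix_iterate_lincomb:
  fixes M :: "'a::field^'n^'n"
  shows "((*v) M ^^ k) (v + c *s w) = ((*v) M ^^ k) v + c *s (((*v) M ^^ k) w)"
  by (induction k) (simp_all add: vec.add vec.scale)

lemma exp_orbit_lincomb: "exp_orbit M (v + c *s w) z = exp_orbit M v z + c *s exp_orbit M w z"
proof -
  let ?a = "\<lambda>i v k. ((((*v) M ^^ k) v) $ i / fact k) * z ^ k"
  have "(\<lambda>k. ?a i v k + c * ?a i w k) sums (suminf (?a i v) + c * suminf (?a i w))" for i
    by (intro sums_add sums_mult summable_sums summable_matrix_exp_component)
  moreover have "?a i (v + c *s w) k = ?a i v k + c * ?a i w k" for i k
    by (simp add: matrix_iterate_lincomb add_divide_distrib distrib_right)
  ultimately show ?thesis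
    by (simp add: exp_orbit_def vec_eq_iff sums_iff)
qed

lemma exp_orbit_0: "exp_orbit M 0 z = 0"
proof -
  have "((*v) M ^^ k) 0 = 0" for k by (induction k) auto
  then show ?thesis by (simp add: exp_orbit_def vec_eq_iff)
qed

text \<open>Termwise differentiation shifts the coefficients by one, which amounts to starting the
  iteration at \<open>M *v v\<close>.\<close>

lemma exp_orbit_has_field_derivative:
  "((\<lambda>z. exp_orbit M v z $ i) has_field_derivative exp_orbit M (M *v v) z $ i) (at z)"
proof -
  let ?c = "\<lambda>k. (((*v) M ^^ k) v) $ i / fact k"
  have "diffs ?c k = (((*v) M ^^ k) (M *v v)) $ i / fact k" for k
    using of_nat_neq_0[where 'a = complex, of k] by (simp add: diffs_def funpow_swap1[of "(*v) M"] del: of_nat_Suc)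
  then show ?thesis
    using termdiffs_strong_converges_everywhere[of ?c z] summable_matrix_exp_component[of M v i]
    by (simp add: exp_orbit_def)
qed

lemma exp_orbit_eigenvector:
  assumes "M *v v = \<mu> *s v"
  shows "exp_orbit M v z = exp (\<mu> * z) *s v"
proof -
  have *: "((*v) M ^^ k) v = \<mu> ^ k *s v" for k
    by (induction k) (simp_all add: assms vec.scale mult_ac)
  have "(\<lambda>k. (\<mu> * z) ^ k /\<^sub>R fact k * v $ i) sums (exp (\<mu> * z) * v $ i)" for i
    by (intro sums_mult2 exp_converges)
  then have "(\<lambda>k. (\<mu> ^ k * v $ i / fact k) * z ^ k) sums (exp (\<mu> * z) * v $ i)" for i
    by (simp add: scaleR_conv_of_real power_mult_distrib field_simps)
  then show ?thesis
    by (simp add: exp_orbit_def * vec_eq_iff sums_iff)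
qed

definition complexify :: "real^'n \<Rightarrow> complex^'n" where
  "complexify x = (\<chi> i. complex_of_real (x $ i))"

text \<open>A real matrix commutes with the embedding of real vectors, hence so do its iterates and
  the limit of the series.\<close>

lemma exp_orbit_complexify:
  "exp_orbit (map_matrix complex_of_real P) (complexify x) (of_real r) =
    complexify (matrix_exp (r *\<^sub>R P) *v x)"
proof -
  have *: "map_matrix complex_of_real P *v complexify y = complexify (P *v y)" for y
    by (simp add: complexify_def map_matrix_def matrix_vector_mult_def vec_eq_iff)
  have "((*v) (map_matrix complex_of_real P) ^^ k) (complexify x) = complexify (((*v) P ^^ k) x)" for k
    by (induction k) (simp_all add: *)
  moreover have "complex_of_real (\<Sum>k. ((((*v) P ^^ k) x) $ i / fact k) * r ^ k) =
      (\<Sum>k. of_real (((((*v) P ^^ k) x) $ i / fact k) * r ^ k))" for i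
    by (rule suminf_of_real) (rule summable_matrix_exp_component)
  ultimately show ?thesis
    by (simp add: exp_orbit_def vec_eq_iff complexify_def matrix_exp_vector_component)
qed

section \<open>A scalar linear equation with vanishing forcing term\<close>

text \<open>The integrating factor exp(cs) removes the term in \<open>u\<close>. Past a point
  \<open>S\<close> where \<open>g\<close> is small, the forcing contributes at most e/2, and the
  contribution of the initial value decays like exp(-Re(c) s).\<close>

lemma linear_ode_tendsto_0:
  fixes u g :: "real \<Rightarrow> complex"
  assumes u: "\<And>s. (u has_vector_derivative (- (c * u s) - g s)) (at s)"
    and g: "(g \<longlongrightarrow> 0) at_top" and pos: "Re c > 0"
  shows "(u \<longlongrightarrow> 0) at_top"
proof (rule tendstoI)
  fix e :: real assume "e > 0"
  define \<rho> where "\<rho> = Re c"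
  \<comment> \<open>Chosen so that \<open>d / \<rho> = e / 2\<close>, the bound on the forced
    part.\<close>
  define d where "d = e * \<rho> / 2"
  have "d > 0" "\<rho> > 0" using \<open>e > 0\<close> pos by (simp_all add: d_def \<rho>_def)
  define h where "h = (\<lambda>s. exp (c * of_real s) * u s)"
  have h': "(h has_vector_derivative - (exp (c * of_real s) * g s)) (at s)" for s
  proof -
    have "((\<lambda>s. exp (c * of_real s)) has_vector_derivative exp (c * of_real s) * c) (at s)"
      by (rule has_vector_derivative_real_field) (auto intro!: derivative_eq_intros)
    from has_vector_derivative_mult[OF this u[of s]] show ?thesis
      unfolding h_def by (simp add: algebra_simps)
  qed
  obtain S where S: "\<And>s. s \<ge> S \<Longrightarrow> norm (g s) \<le> d"
    using tendstoD[OF g \<open>d > 0\<close>] unfolding eventually_at_top_linorder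
    by (auto intro: less_imp_le)
  have bound: "norm (u s) \<le> exp (- \<rho> * s) * norm (h S) + e / 2" if "s > S" for s
  proof -
    \<comment> \<open>Mean value inequality: the derivative of \<open>h\<close> is dominated by that
      of the real function \<open>d / \<rho> * exp (\<rho> * s)\<close>.\<close>
    have "norm (h s - h S) \<le> d / \<rho> * exp (\<rho> * s) - d / \<rho> * exp (\<rho> * S)"
    proof (rule differentiable_bound_general[OF that])
      show "continuous_on {S..s} h"
        using h' by (meson continuous_at_imp_continuous_on has_vector_derivative_continuous)
      show "continuous_on {S..s} (\<lambda>s. d / \<rho> * exp (\<rho> * s))"
        by (intro continuous_intros)
      show "((\<lambda>s. d / \<rho> * exp (\<rho> * s)) has_vector_derivative d * exp (\<rho> * x)) (at x)" for x
        using \<open>\<rho> > 0\<close> unfolding has_real_derivative_iff_has_vector_derivative[symmetric]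
        by (auto intro!: derivative_eq_intros)
      show "norm (- (exp (c * of_real x) * g x)) \<le> d * exp (\<rho> * x)" if "S < x" "x < s" for x
        using S[of x] that by (simp add: norm_mult \<rho>_def mult.commute[of d] mult_left_mono)
    qed (use h' in auto)
    also have "\<dots> \<le> d / \<rho> * exp (\<rho> * s)"
      using \<open>d > 0\<close> \<open>\<rho> > 0\<close> by simp
    finally have "norm (h s) \<le> norm (h S) + e / 2 * exp (\<rho> * s)"
      using norm_triangle_ineq2[of "h s" "h S"] \<open>\<rho> > 0\<close> by (simp add: d_def)
    then have "exp (- \<rho> * s) * norm (h s) \<le> exp (- \<rho> * s) * (norm (h S) + e / 2 * exp (\<rho> * s))"
      by (intro mult_left_mono) auto
    then show ?thesis
      by (simp add: h_def norm_mult \<rho>_def exp_minus field_simps)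
  qed
  have "((\<lambda>s. exp (- \<rho> * s) * norm (h S)) \<longlongrightarrow> 0) at_top"
    using \<open>\<rho> > 0\<close>
    by (intro tendsto_mult_left_zero filterlim_compose[OF exp_at_bot]
        filterlim_tendsto_neg_mult_at_bot[OF tendsto_const _ filterlim_ident]) simp
  then have "eventually (\<lambda>s. exp (- \<rho> * s) * norm (h S) < e / 2) at_top"
    using \<open>e > 0\<close> by (intro order_tendstoD(2)) auto
  with eventually_gt_at_top[of S] show "eventually (\<lambda>s. dist (u s) 0 < e) at_top"
    by eventually_elim (use bound in fastforce)
qed

section \<open>Polynomials annihilating a vector, and decay of complex orbits\<close>

text \<open>The vector p(M) v, expressed through the iterates of \<open>M\<close> on
  \<open>v\<close>.\<close>

definition poly_orbit :: "'a::field^'n^'n \<Rightarrow> 'a poly \<Rightarrow> 'a^'n \<Rightarrow> 'a^'n" where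
  "poly_orbit M p v = (\<Sum>k\<le>degree p. coeff p k *s (((*v) M ^^ k) v))"

text \<open>Padding with zero coefficients gives polynomials of different degrees a common summation
  range.\<close>

lemma poly_orbit_upto:
  "degree p \<le> n \<Longrightarrow> poly_orbit M p v = (\<Sum>k\<le>n. coeff p k *s (((*v) M ^^ k) v))"
  unfolding poly_orbit_def
  by (rule sum.mono_neutral_left) (auto simp: coeff_eq_0)

lemma poly_orbit_add: "poly_orbit M (p + q) v = poly_orbit M p v + poly_orbit M q v"
  using degree_add_le_max[of p q]
  by (simp add: poly_orbit_upto[where n = "max (degree p) (degree q)"] vec.scale_left_distrib sum.distrib)

lemma poly_orbit_smult: "poly_orbit M (smult c p) v = c *s poly_orbit M p v"
  using degree_smult_le[of c p]
  by (simp add: poly_orbit_upto[where n = "degree p"] vec.scale_sum_right)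

lemma poly_orbit_pCons_0: "poly_orbit M (pCons 0 p) v = poly_orbit M p (M *v v)"
  using degree_pCons_le[of 0 p]
  by (simp add: poly_orbit_upto[where n = "Suc (degree p)"] sum.atMost_Suc_shift funpow_swap1[of "(*v) M"]
      poly_orbit_def del: sum.atMost_Suc)

lemma poly_orbit_matrix: "poly_orbit M p (M *v v) = M *v poly_orbit M p v"
  by (simp add: poly_orbit_def vec.sum vec.scale funpow_swap1[of "(*v) M"])

lemma poly_orbit_linear_factor:
  "poly_orbit M ([:- c, 1:] * q) v = M *v poly_orbit M q v - c *s poly_orbit M q v"
proof -
  have "[:- c, 1:] * q = smult (- c) q + pCons 0 q" by simp
  then show ?thesis
    by (simp only: poly_orbit_add poly_orbit_smult poly_orbit_pCons_0 poly_orbit_matrix) simp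
qed

lemma poly_orbit_lincomb:
  "poly_orbit M p (v + c *s w) = poly_orbit M p v + c *s poly_orbit M p w"
  by (simp add: poly_orbit_def matrix_iterate_lincomb vec.scale_right_distrib sum.distrib
    vec.scale_sum_right mult.commute)

text \<open>The \<open>CARD('n) + 1\<close> vectors v, Mv, ... up to exponent
  \<open>CARD('n)\<close> cannot be independent; a linear relation between them is the
  polynomial.\<close>

lemma exists_annihilating_poly:
  fixes M :: "'a::field^'n^'n"
  obtains p where "p \<noteq> 0" "poly_orbit M p v = 0"
proof -
  let ?n = "CARD('n)" and ?f = "\<lambda>k. ((*v) M ^^ k) v"
  show ?thesis
  \<comment> \<open>Dependence is a property of sets. Only when the iterates are distinct can the
    coefficients be indexed by the exponent; a repetition at i and j instead gives the polynomial
    X^i - X^j.\<close>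
  proof (cases "inj_on ?f {..?n}")
    case True
    have "vec.dependent (?f ` {..?n})"
    proof (rule vec.dependent_biggerset_general)
      show "card (?f ` {..?n}) > vec.dim (?f ` {..?n})"
        using card_image[OF True] vec.dim_subset_UNIV[of "?f ` {..?n}"] by (simp add: vec_dim_card vec.dimension_def card_cart_basis)
    qed
    then obtain c where c: "\<exists>w\<in>?f ` {..?n}. c w \<noteq> 0" "(\<Sum>w\<in>?f ` {..?n}. c w *s w) = 0"
      by (subst (asm) vec.dependent_finite) auto
    define p where "p = (\<Sum>k\<le>?n. monom (c (?f k)) k)"
    have coeff: "coeff p k = (if k \<le> ?n then c (?f k) else 0)" for k
      by (simp add: p_def coeff_sum)
    obtain k where "k \<le> ?n" "c (?f k) \<noteq> 0" using c(1) by auto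
    then have "coeff p k \<noteq> 0" by (simp add: coeff)
    then have "p \<noteq> 0" by auto
    moreover have "poly_orbit M p v = (\<Sum>k\<le>?n. c (?f k) *s ?f k)"
      by (subst poly_orbit_upto[where n = ?n]) (auto simp: coeff intro!: degree_le)
    then have "poly_orbit M p v = 0"
      using c(2) by (simp add: sum.reindex[OF True])
    ultimately show ?thesis by (rule that)
  next
    case False
    then obtain i j where ij: "i \<noteq> j" "?f i = ?f j" by (auto simp: inj_on_def)
    have monom: "poly_orbit M (monom c k) v = c *s ?f k" for c k
    proof -
      have "poly_orbit M (monom c k) v = (\<Sum>l\<le>k. (if k = l then c *s ?f l else 0))"
        by (subst poly_orbit_upto[where n = k]) (auto simp: degree_monom_le if_distrib[of "\<lambda>c. c *s _"] cong: if_cong intro!: sum.cong)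
      then show ?thesis by simp
    qed
    show ?thesis
    proof (rule that)
      show "monom 1 i + monom (- 1) j \<noteq> (0 :: 'a poly)"
        using ij(1) by (auto simp: poly_eq_iff dest: spec[of _ i])
      show "poly_orbit M (monom 1 i + monom (- 1) j) v = 0"
        by (simp add: poly_orbit_add monom ij(2))
    qed
  qed
qed

text \<open>Peel off a root \<open>c\<close> of a polynomial annihilating \<open>v\<close>: with \<open>w = M v - c v\<close>, each component
  of the orbit of \<open>v\<close> solves the scalar equation \<open>u' = - c u - g\<close>, where \<open>g\<close> comes from the orbit of
  \<open>w\<close>. A root that is not an eigenvalue can be cancelled from the polynomial.\<close>
lemma exp_orbit_tendsto_0:
  fixes M :: "complex^'n^'n"
  assumes ev: "\<And>\<mu> v. v \<noteq> 0 \<Longrightarrow> M *v v = \<mu> *s v \<Longrightarrow> Re \<mu> > 0"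
  shows "((\<lambda>s. exp_orbit M v (of_real (- s)) $ i) \<longlongrightarrow> 0) at_top"
proof -
  have main: "((\<lambda>s. exp_orbit M v (of_real (- s)) $ i) \<longlongrightarrow> 0) at_top"
    if "p \<noteq> 0" "poly_orbit M p v = 0" for p v
    using that
  proof (induction "degree p" arbitrary: p v)
    case 0
    then obtain c where "p = [:c:]" by (metis degree_eq_zeroE)
    \<comment> \<open>A nonzero constant polynomial annihilates only the zero vector.\<close>
    with 0 have "v = 0" by (simp add: poly_orbit_def)
    then show ?case by (simp add: exp_orbit_0)
  next
    case (Suc n)
    obtain c where "poly p c = 0"
      using fundamental_theorem_of_algebra_alt[of p] Suc by force
    then obtain q where q: "p = [:- c, 1:] * q"
      by (auto simp: poly_eq_0_iff_dvd)
    with Suc have "q \<noteq> 0" by auto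
    then have deg: "n = degree q"
      using Suc(2) degree_mult_eq[of "[:- c, 1:]" q] unfolding q by simp
    have eig: "M *v poly_orbit M q v = c *s poly_orbit M q v"
      using Suc.prems(2) unfolding q poly_orbit_linear_factor by simp
    \<comment> \<open>Here q(M) w = (M - c) q(M) v = p(M) v = 0, so the induction hypothesis covers
      \<open>w\<close> with the smaller polynomial \<open>q\<close>.\<close>
    define w where "w = M *v v + (- c) *s v"
    have "poly_orbit M q w = 0"
      unfolding w_def poly_orbit_lincomb poly_orbit_matrix eig by (simp add: vec.scale_minus_left)
    with Suc.hyps(1)[OF deg \<open>q \<noteq> 0\<close>]
    have lim_w: "((\<lambda>s. exp_orbit M w (of_real (- s)) $ i) \<longlongrightarrow> 0) at_top" by blast
    show ?case
    proof (cases "poly_orbit M q v = 0")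
      case True
      then show ?thesis using Suc.hyps(1)[OF deg \<open>q \<noteq> 0\<close>] by blast
    next
      case False
      then have "Re c > 0" using ev eig by blast
      have Mv: "exp_orbit M (M *v v) z $ i = c * exp_orbit M v z $ i + exp_orbit M w z $ i" for z
      proof -
        have "M *v v = w + c *s v" by (simp add: w_def vec.scale_minus_left)
        then show ?thesis by (simp add: exp_orbit_lincomb)
      qed
      \<comment> \<open>Time runs backwards, so the chain rule contributes the factor -1 and turns
        growth at rate Re c into decay.\<close>
      have "((\<lambda>s. exp_orbit M v (of_real (- s)) $ i) has_vector_derivative
          (- (c * exp_orbit M v (of_real (- s)) $ i) - exp_orbit M w (of_real (- s)) $ i)) (at s)" for s
      proof -
        have "((\<lambda>s. of_real (- s) :: complex) has_vector_derivative - 1) (at s)"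
          by (auto intro!: derivative_eq_intros)
        from field_vector_diff_chain_at[OF this exp_orbit_has_field_derivative[of M v i]]
        show ?thesis by (simp add: o_def Mv)
      qed
      from linear_ode_tendsto_0[OF this lim_w \<open>Re c > 0\<close>] show ?thesis .
    qed
  qed
  obtain p where "p \<noteq> 0" "poly_orbit M p v = 0" by (rule exists_annihilating_poly)
  then show ?thesis by (rule main)
qed

section \<open>Passage between real and complex vectors\<close>

lemma norm_vec_power2: "(norm x)\<^sup>2 = (\<Sum>i\<in>UNIV. (norm (x $ i))\<^sup>2)"
  by (simp add: norm_vec_def L2_set_def sum_nonneg)

lemma norm_complexify_add_ii:
  "(norm (complexify a + \<i> *s complexify b))\<^sup>2 = (norm a)\<^sup>2 + (norm b)\<^sup>2"
  by (simp add: complexify_def norm_vec_power2 cmod_power2 sum.distrib)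

lemma complexify_cases:
  obtains a b where "v = complexify a + \<i> *s complexify b"
proof
  show "v = complexify (\<chi> i. Re (v $ i)) + \<i> *s complexify (\<chi> i. Im (v $ i))"
    by (simp add: complexify_def vec_eq_iff complex_eq_iff)
qed

lemma eigenvalue_Re_pos_if_expanding:
  fixes P :: "real^'n^'n"
  assumes "r > 0" and expand: "\<And>x. x \<noteq> 0 \<Longrightarrow> norm (matrix_exp (r *\<^sub>R P) *v x) > norm x"
    and "complex_eigenvalue P \<mu>"
  shows "Re \<mu> > 0"
proof -
  let ?M = "map_matrix complex_of_real P" and ?E = "matrix_exp (r *\<^sub>R P)"
  obtain v where "v \<noteq> 0" and v: "?M *v v = \<mu> *s v"
    using assms(3) unfolding complex_eigenvalue_def by blast
  obtain a b where ab: "v = complexify a + \<i> *s complexify b" by (rule complexify_cases)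
  have "a \<noteq> 0 \<or> b \<noteq> 0"
    using \<open>v \<noteq> 0\<close> ab by (auto simp: complexify_def vec_eq_iff)
  have le: "(norm x)\<^sup>2 \<le> (norm (?E *v x))\<^sup>2" for x
    using expand[of x] by (cases "x = 0") (auto intro: power_mono)
  have less: "(norm x)\<^sup>2 < (norm (?E *v x))\<^sup>2" if "x \<noteq> 0" for x
    using expand[OF that] by (intro power_strict_mono) auto
  \<comment> \<open>Expansion is strict on whichever of \<open>a\<close>, \<open>b\<close> is
    nonzero and weak on the other; the squared norms of the two parts add up.\<close>
  have "(norm v)\<^sup>2 < (norm (?E *v a))\<^sup>2 + (norm (?E *v b))\<^sup>2"
    unfolding ab norm_complexify_add_ii
    using \<open>a \<noteq> 0 \<or> b \<noteq> 0\<close> le less by (meson add_le_less_mono add_less_le_mono)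
  also have "\<dots> = (norm (exp_orbit ?M v (of_real r)))\<^sup>2"
    by (simp add: ab exp_orbit_lincomb exp_orbit_complexify norm_complexify_add_ii)
  also have "\<dots> = (exp (Re \<mu> * r) * norm v)\<^sup>2"
    by (simp add: exp_orbit_eigenvector[OF v] norm_vec_power2 norm_mult power_mult_distrib
        sum_distrib_left)
  finally have "norm v < exp (Re \<mu> * r) * norm v"
    by (rule power_less_imp_less_base) simp
  then have "exp (Re \<mu> * r) > 1" using \<open>v \<noteq> 0\<close> by simp
  then show ?thesis using \<open>r > 0\<close> by (simp add: zero_less_mult_iff)
qed

text \<open>The complex orbit of a real vector at real times is real, so its decay is the real decay
  in each coordinate.\<close>

lemma matrix_exp_tendsto_0:
  fixes P :: "real^'n^'n"
  assumes "\<And>\<mu>. complex_eigenvalue P \<mu> \<Longrightarrow> Re \<mu> > 0"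
  shows "((\<lambda>s. matrix_exp ((- s) *\<^sub>R P) *v x) \<longlongrightarrow> 0) at_top"
proof (rule vec_tendstoI)
  fix i
  have "((\<lambda>s. exp_orbit (map_matrix complex_of_real P) (complexify x) (of_real (- s)) $ i) \<longlongrightarrow> 0) at_top"
    by (rule exp_orbit_tendsto_0) (use assms in \<open>unfold complex_eigenvalue_def, blast\<close>)
  then have "((\<lambda>s. complex_of_real ((matrix_exp ((- s) *\<^sub>R P) *v x) $ i)) \<longlongrightarrow> of_real 0) at_top"
    unfolding exp_orbit_complexify by (simp add: complexify_def)
  then show "((\<lambda>s. (matrix_exp ((- s) *\<^sub>R P) *v x) $ i) \<longlongrightarrow> 0 $ i) at_top"
    unfolding tendsto_of_real_iff by simp
qed

section \<open>Operator norm bounds and strict expansion\<close>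

text \<open>A bound for the operator norm by finitely many values of \<open>f\<close>, so that
  pointwise convergence to zero forces convergence in norm.\<close>

lemma norm_linear_le_sum_axis:
  fixes f :: "real^'n \<Rightarrow> 'b::real_normed_vector"
  assumes "linear f"
  shows "norm (f x) \<le> (\<Sum>i\<in>UNIV. norm (f (axis i 1))) * norm x"
proof -
  have "f x = f (\<Sum>i\<in>UNIV. (x $ i) *\<^sub>R axis i 1)"
    by (simp add: basis_expansion flip: scalar_mult_eq_scaleR)
  also have "\<dots> = (\<Sum>i\<in>UNIV. (x $ i) *\<^sub>R f (axis i 1))"
    using assms by (simp add: linear_sum linear_scale)
  also have "norm \<dots> \<le> (\<Sum>i\<in>UNIV. norm x * norm (f (axis i 1)))"
    by (rule sum_norm_le) (simp add: component_le_norm_cart mult_right_mono)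
  finally show ?thesis by (simp add: sum_distrib_left mult.commute)
qed

lemma expanding_if_tendsto_0:
  assumes A: "continuous_group A"
    and lim: "\<And>x. ((\<lambda>t. norm (A t x)) \<longlongrightarrow> 0) (at_right 0)"
  obtains t0 where "t0 > 1" "\<And>x. x \<noteq> 0 \<Longrightarrow> norm (A t0 x) > norm x"
proof -
  have "((\<lambda>t. \<Sum>i\<in>UNIV. norm (A t (axis i 1))) \<longlongrightarrow> 0) (at_right 0)"
    using tendsto_sum[of UNIV "\<lambda>i t. norm (A t (axis i 1))" "\<lambda>_. 0"] lim by simp
  then have "eventually (\<lambda>t. (\<Sum>i\<in>UNIV. norm (A t (axis i 1))) < 1) (at_right 0)"
    by (rule order_tendstoD) simp
  moreover have "eventually (\<lambda>t. t \<in> {0<..<1}) (at_right (0::real))"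
    by (rule eventually_at_right_real) simp
  ultimately have "eventually (\<lambda>t. (\<Sum>i\<in>UNIV. norm (A t (axis i 1))) < 1 \<and> t \<in> {0<..<1}) (at_right 0)"
    by (rule eventually_conj)
  then obtain t where t: "0 < t" "t < 1" and less: "(\<Sum>i\<in>UNIV. norm (A t (axis i 1))) < 1"
    by (auto dest!: eventually_happens)
  show ?thesis
  proof (rule that)
    \<comment> \<open>\<open>A (1 / t)\<close> is the inverse of the strict contraction
      \<open>A t\<close>.\<close>
    show "1 / t > 1" using t by simp
    fix x :: "real^'a" assume "x \<noteq> 0"
    have "A t \<circ> A (1 / t) = A (1 / t * t)"
      using A t unfolding continuous_group_def by simp
    also have "\<dots> = id"
      using A t unfolding continuous_group_def by simp
    finally have x: "A t (A (1 / t) x) = x" by (metis comp_apply id_apply)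
    have lin: "linear (A t)" using A t by (simp add: continuous_group_def)
    then have "A (1 / t) x \<noteq> 0" using x \<open>x \<noteq> 0\<close> linear_0 by metis
    then have "(\<Sum>i\<in>UNIV. norm (A t (axis i 1))) * norm (A (1 / t) x) < norm (A (1 / t) x)"
      using less by simp
    with norm_linear_le_sum_axis[OF lin, of "A (1 / t) x"] show "norm (A (1 / t) x) > norm x"
      unfolding x by simp
  qed
qed

theorem theorem2p4:
  fixes A :: "real \<Rightarrow> real^'n \<Rightarrow> real^'n" and P :: "real^'n^'n"
  assumes "continuous_group A" and "generator A P"
  shows "((\<forall>x. ((\<lambda>t. norm (A t x)) \<longlongrightarrow> 0) (at_right 0))
            \<longleftrightarrow> (\<forall>\<mu>. complex_eigenvalue P \<mu> \<longrightarrow> Re \<mu> > 0))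
       \<and> ((\<forall>\<mu>. complex_eigenvalue P \<mu> \<longrightarrow> Re \<mu> > 0)
            \<longleftrightarrow> (\<exists>t0>1. \<forall>x. x \<noteq> 0 \<longrightarrow> norm (A t0 x) > norm x))"
    (is "(?a \<longleftrightarrow> ?b) \<and> (?b \<longleftrightarrow> ?c)")
proof -
  have gen: "A t x = matrix_exp (ln t *\<^sub>R P) *v x" if "t > 0" for t x
    using assms(2) that by (simp add: generator_def)
  have "?c" if ?a
    using expanding_if_tendsto_0[OF assms(1)] that by metis
  moreover have "?b" if ?c
  proof -
    from that obtain t0 where t0: "t0 > 1" "\<And>x. x \<noteq> 0 \<Longrightarrow> norm (A t0 x) > norm x" by blast
    then show ?thesis
      \<comment> \<open>The exponent \<open>ln t0\<close> is positive because
        \<open>t0 > 1\<close>.\<close>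
      using eigenvalue_Re_pos_if_expanding[of "ln t0" P] by (simp add: gen)
  qed
  moreover have "?a" if ?b
  proof
    fix x
    \<comment> \<open>The substitution s = -ln t carries t -> 0+ to s -> infinity.\<close>
    have "filterlim (\<lambda>t. - ln t) at_top (at_right (0::real))"
      using ln_at_0 by (simp add: filterlim_uminus_at_bot)
    from filterlim_compose[OF matrix_exp_tendsto_0 this, of P x]
    have "((\<lambda>t. matrix_exp (ln t *\<^sub>R P) *v x) \<longlongrightarrow> 0) (at_right 0)"
      using that by simp
    then have "((\<lambda>t. norm (matrix_exp (ln t *\<^sub>R P) *v x)) \<longlongrightarrow> 0) (at_right 0)"
      by (rule tendsto_norm_zero)
    then show "((\<lambda>t. norm (A t x)) \<longlongrightarrow> 0) (at_right 0)"
      \<comment> \<open>\<open>gen\<close> identifies \<open>A t\<close> with the exponential only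
        for positive t, which holds eventually in \<open>at_right 0\<close>.\<close>
      by (rule Lim_transform_eventually)
        (auto simp: gen eventually_at_right_less intro!: eventually_mono[OF eventually_at_right_less])
  qed
  ultimately show ?thesis by blast
qed

end
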